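(* Let $\alpha_k$ be defined by $\alpha_k=q^{3r^2-2r}$ if $k=3r-1$, $\alpha_k=q^{3r^2+2r}$ if $k=3r$, $\alpha_k=-q^{3r^2+4r+1}-q^{3r^2+2r}$ if $k=3r+1$. Then for every integer $p\ge1$, every positive integer $N$ and every primitive $N$th root of unity $q$, $$H_p^{(4)}(q)=\sum_{k=0}^{N-1}(-1)^kq^{\binom{k+1}{2}+(p-1)(k^2+k)}\alpha_k.$$
   Context: $(a)_n=\prod_{k=1}^n(1-aq^{k-1})$, $\begin{bmatrix} n\\ k\end{bmatrix}=\frac{(q)_n}{(q)_{n-k}(q)_k}$. $H_p^{(4)}(q)=\sum_{n_p\ge\cdots\ge n_1\ge0}q^{n_p}(q^{n_p+1})_{n_p}\prod_{i=1}^{p-1}q^{n_i(n_i+1)}\begin{bmatrix} n_{i+1}\\ n_i\end{bmatrix}$; at a root of unity only finitely many terms are nonzero. *)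

theory Defs
  imports "HOL-Analysis.Analysis"
begin

definition primitive_unity_root :: "nat \<Rightarrow> complex \<Rightarrow> bool" where
  "primitive_unity_root N q \<longleftrightarrow> N > 0 \<and> q ^ N = 1 \<and> (\<forall>m\<in>{1..<N}. q ^ m \<noteq> 1)"

definition qpoch :: "complex \<Rightarrow> complex \<Rightarrow> nat \<Rightarrow> complex" where
  "qpoch a q n = (\<Prod>k=1..n. 1 - a * q ^ (k - 1))"

text \<open>
  The usual \<open>(q)\<^sub>n\<close> is \<open>qpoch q q n\<close>. At a primitive \<open>N\<close>-th root of unity the denominator below is
  nonzero for \<open>k \<le> n < N\<close> (lemma \<open>qpoch_nonzero\<close>). For \<open>n \<ge> N\<close> it may vanish; this is harmless in
  \<open>H4\<close>, where all terms with \<open>n\<^sub>p \<ge> N\<close> carry a factor \<open>0\<close> (lemma \<open>qpoch_zero\<close>).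
\<close>
definition qbinom :: "complex \<Rightarrow> nat \<Rightarrow> nat \<Rightarrow> complex" where
  "qbinom q n k = qpoch q q n / (qpoch q q (n - k) * qpoch q q k)"

text \<open>
  Tuples \<open>n\<^sub>p \<ge> \<dots> \<ge> n\<^sub>1 \<ge> 0\<close> are monotone functions on \<open>{1..p}\<close>; extensionality (the fixed value
  outside \<open>{1..p}\<close>) makes each tuple occur exactly once.
\<close>
definition chains :: "nat \<Rightarrow> (nat \<Rightarrow> nat) set" where
  "chains p = {n \<in> {1..p} \<rightarrow>\<^sub>E UNIV. mono_on {1..p} n}"

definition H4_term :: "nat \<Rightarrow> complex \<Rightarrow> (nat \<Rightarrow> nat) \<Rightarrow> complex" where
  "H4_term p q n = q ^ n p * qpoch (q ^ (n p + 1)) q (n p) *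
     (\<Prod>i=1..p-1. q ^ (n i * (n i + 1)) * qbinom q (n (i + 1)) (n i))"

text \<open>
  At a root of unity only finitely many terms are nonzero (lemma \<open>finite_H4_support\<close>), so this is
  a finite sum there.
\<close>
definition H4 :: "nat \<Rightarrow> complex \<Rightarrow> complex" where
  "H4 p q = (\<Sum>\<^sub>\<infinity>n\<in>chains p. H4_term p q n)"

text \<open>In all three residue classes \<open>k = 3r - 1, 3r, 3r + 1\<close> one has \<open>r = (k + 1) div 3\<close>.\<close>
definition alpha :: "complex \<Rightarrow> nat \<Rightarrow> complex" where
  "alpha q k = (let r = (k + 1) div 3 in
     if k mod 3 = 2 then q ^ (3 * r\<^sup>2 - 2 * r)
     else if k mod 3 = 0 then q ^ (3 * r\<^sup>2 + 2 * r)
     else - (q ^ (3 * r\<^sup>2 + 4 * r + 1)) - q ^ (3 * r\<^sup>2 + 2 * r))"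

lemma alpha_cases:
  shows "r \<ge> 1 \<Longrightarrow> alpha q (3 * r - 1) = q ^ (3 * r\<^sup>2 - 2 * r)"
    and "alpha q (3 * r) = q ^ (3 * r\<^sup>2 + 2 * r)"
    and "alpha q (3 * r + 1) = - (q ^ (3 * r\<^sup>2 + 4 * r + 1)) - q ^ (3 * r\<^sup>2 + 2 * r)"
proof -
  show "alpha q (3 * r - 1) = q ^ (3 * r\<^sup>2 - 2 * r)" if r1: "r \<ge> 1"
  proof -
    obtain s where r: "r = Suc s" using r1 by (cases r) auto
    have "3 * r - 1 = 2 + 3 * s" "3 * r - 1 + 1 = 3 * r" using r by simp_all
    moreover have "(2 + 3 * s) mod 3 = 2" by (subst mod_mult_self2) simp
    ultimately have "(3 * r - 1) mod 3 = 2" "(3 * r - 1 + 1) div 3 = r"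
      by (simp_all only:)
    then show ?thesis unfolding alpha_def Let_def by (simp only: if_True refl)
  qed
  have "(3 * r) mod 3 = 0" "(3 * r + 1) div 3 = r" by simp_all
  then show "alpha q (3 * r) = q ^ (3 * r\<^sup>2 + 2 * r)"
    unfolding alpha_def Let_def by (simp only:) simp
  have "(3 * r + 1) mod 3 = 1" "(3 * r + 1 + 1) div 3 = r" by presburger+
  then show "alpha q (3 * r + 1) = - (q ^ (3 * r\<^sup>2 + 4 * r + 1)) - q ^ (3 * r\<^sup>2 + 2 * r)"
    unfolding alpha_def Let_def by (simp only:) simp
qed

lemma qpoch_nonzero:
  assumes "primitive_unity_root N q" "n < N"
  shows "qpoch q q n \<noteq> 0"
proof -
  have "1 - q * q ^ (k - 1) \<noteq> 0" if "k \<in> {1..n}" for k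
  proof -
    have "q * q ^ (k - 1) = q ^ k" using that by (cases k) auto
    then show ?thesis using that assms by (auto simp: primitive_unity_root_def)
  qed
  then show ?thesis by (simp add: qpoch_def)
qed

lemma qpoch_zero:
  assumes "primitive_unity_root N q" "n \<ge> N"
  shows "qpoch (q ^ (n + 1)) q n = 0"
proof -
  have N: "N > 0" "q ^ N = 1" using assms by (auto simp: primitive_unity_root_def)
  define k where "k = N - n mod N"
  have k: "k \<in> {1..n}" using N assms(2) by (auto simp: k_def Suc_le_eq)
  have "n + k = N * (n div N) + N"
    using mod_less_divisor[OF N(1), of n] mult_div_mod_eq[of N n]
    unfolding k_def by linarith
  then have "n + k = N * (n div N + 1)" by simp
  then have "q ^ (n + k) = 1" using N(2) by (metis power_mult power_one)
  moreover have "q ^ (n + 1) * q ^ (k - 1) = q ^ (n + k)"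
    using k by (cases k) (auto simp: power_add)
  ultimately have "1 - q ^ (n + 1) * q ^ (k - 1) = 0" by simp
  then show ?thesis using k unfolding qpoch_def by (intro prod_zero) auto
qed

lemma finite_H4_support:
  assumes "primitive_unity_root N q" "p \<ge> 1"
  shows "finite {n \<in> chains p. H4_term p q n \<noteq> 0}"
proof (rule finite_subset)
  show "finite ({1..p} \<rightarrow>\<^sub>E {..<N})" by (intro finite_PiE) auto
  show "{n \<in> chains p. H4_term p q n \<noteq> 0} \<subseteq> {1..p} \<rightarrow>\<^sub>E {..<N}"
  proof clarify
    fix n assume n: "n \<in> chains p" "H4_term p q n \<noteq> 0"
    have "n p < N"
      using n(2) qpoch_zero[OF assms(1), of "n p"] by (force simp: H4_term_def)
    moreover have "n i \<le> n p" if "i \<in> {1..p}" for i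
      using n(1) that assms(2) by (auto simp: chains_def intro: mono_onD)
    ultimately have "n i < N" if "i \<in> {1..p}" for i
      using that le_less_trans by blast
    then show "n \<in> {1..p} \<rightarrow>\<^sub>E {..<N}"
      using n(1) by (simp add: chains_def PiE_iff)
  qed
qed

end

theory Submission
  imports Defs
begin

text \<open>
  Iterating the Bailey lemma with \<open>a = q\<close> on the unit Bailey pair gives, for \<open>|q| < 1\<close>, an expansion
  of \<open>(q\<^bsup>n+1\<^esup>)\<^sub>n\<close> times the inner chain sum as a combination of the
  differences \<open>[2n, n-k] - q\<^bsup>2k+1\<^esup> [2n, n-k-1]\<close>. Written with polynomial \<open>q\<close>-binomials it
  extends by continuity to \<open>|q| = 1\<close>. After exchanging sums one needs
  \<open>T\<^sub>k = \<Sum>\<^bsub>n<N\<^esub> q\<^sup>n [2n, n-k]\<close>; telescoping in \<open>n\<close> relates \<open>T\<^sub>k\<close> to \<open>T\<^bsub>k+3\<^esub>\<close> up to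
  boundary terms \<open>[2N, i]\<close>, which vanish at a primitive \<open>N\<close>-th root of unity for \<open>0 < i < N\<close>. Solving
  the recurrence downwards from \<open>k = N - 1\<close> produces \<open>\<alpha>\<^bsub>N-1-k\<^esub>\<close>, and the remaining weight is
  invariant under \<open>k \<mapsto> N - 1 - k\<close>.
\<close>

section \<open>Gaussian binomial coefficients\<close>

text \<open>
  Defined by the Pascal recurrence rather than as the quotient \<^const>\<open>qbinom\<close>, so that it is a
  polynomial in \<open>q\<close> and stays meaningful when \<open>(q)\<^sub>k\<close> vanishes.
\<close>
fun gauss :: "complex \<Rightarrow> nat \<Rightarrow> nat \<Rightarrow> complex" where
  "gauss q n 0 = 1"
| "gauss q 0 (Suc k) = 0"
| "gauss q (Suc n) (Suc k) = gauss q n k + q ^ Suc k * gauss q n (Suc k)"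

lemma gauss_eq_0: "n < k \<Longrightarrow> gauss q n k = 0"
  by (induction q n k rule: gauss.induct) auto

lemma gauss_self [simp]: "gauss q n n = 1"
  by (induction n) (auto simp: gauss_eq_0)

text \<open>The ratio of neighbouring entries in a row, multiplied out so that it survives at roots
  of unity. The Pascal rule reduces row n+1 to two instances in row n.\<close>

lemma gauss_absorb:
  "k \<le> n \<Longrightarrow> (1 - q ^ Suc k) * gauss q n (Suc k) = (1 - q ^ (n - k)) * gauss q n k"
proof (induction n arbitrary: k)
  case (Suc n)
  show ?case
  proof (cases k)
    case 0
    have "(1 - q) * (1 + q * gauss q n (Suc 0)) = 1 - q + q * ((1 - q) * gauss q n (Suc 0))"
      by (simp add: algebra_simps)
    also have "\<dots> = 1 - q ^ Suc n"
      using Suc.IH[of 0] by (simp add: right_diff_distrib)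
    finally show ?thesis using 0 by simp
  next
    case (Suc j)
    show ?thesis
    proof (cases "j = n")
      case True
      then show ?thesis using Suc by (simp add: gauss_eq_0)
    next
      case False
      then obtain d where n: "n = Suc (j + d)"
        using Suc \<open>k \<le> Suc n\<close> by (metis Suc_le_mono le_neq_implies_less less_imp_Suc_add)
      have 1: "(1 - q ^ Suc (Suc j)) * gauss q n (Suc (Suc j)) = (1 - q ^ d) * gauss q n (Suc j)"
        using Suc.IH[of "Suc j"] n by simp
      have 2: "(1 - q ^ Suc j) * gauss q n (Suc j) = (1 - q ^ Suc d) * gauss q n j"
        using Suc.IH[of j] n by (simp add: Suc_diff_le)
      have "(1 - q ^ Suc (Suc j)) * gauss q (Suc n) (Suc (Suc j)) =
          (1 - q ^ Suc (Suc j)) * gauss q n (Suc j) +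
          q ^ Suc (Suc j) * ((1 - q ^ Suc (Suc j)) * gauss q n (Suc (Suc j)))"
        by (simp add: algebra_simps)
      also have "\<dots> = (1 - q ^ Suc j) * gauss q n (Suc j) +
          q ^ Suc j * (1 - q ^ Suc d) * gauss q n (Suc j)"
        unfolding 1 by (simp add: algebra_simps power_add)
      also have "\<dots> = (1 - q ^ Suc d) * gauss q (Suc n) (Suc j)"
        unfolding 2 by (simp add: algebra_simps)
      finally show ?thesis using Suc n by (simp add: Suc_diff_le)
    qed
  qed
qed simp

text \<open>The mirrored Pascal rule: it differs from the defining one exactly by
  \<open>gauss_absorb\<close>.\<close>

lemma gauss_Suc_Suc':
  "k \<le> n \<Longrightarrow> gauss q (Suc n) (Suc k) = q ^ (n - k) * gauss q n k + gauss q n (Suc k)"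
  using gauss_absorb[of k n q] by (simp add: algebra_simps)

lemma qpoch_0 [simp]: "qpoch a q 0 = 1"
  by (simp add: qpoch_def)

lemma qpoch_Suc: "qpoch a q (Suc n) = qpoch a q n * (1 - a * q ^ n)"
  by (simp add: qpoch_def)

lemma qpoch_add: "qpoch a q (m + n) = qpoch a q m * qpoch (a * q ^ m) q n"
  by (induction n) (simp_all add: qpoch_Suc power_add mult.assoc)

text \<open>Links the recursive coefficients to the factorial quotient; as a product it holds even
  where \<open>qpoch q q k\<close> vanishes.\<close>

lemma gauss_qpoch:
  "k \<le> n \<Longrightarrow> gauss q n k * (qpoch q q (n - k) * qpoch q q k) = qpoch q q n"
proof (induction k)
  case (Suc k)
  then have d: "n - k = Suc (n - Suc k)" by simp
  have "gauss q n (Suc k) * (qpoch q q (n - Suc k) * qpoch q q (Suc k)) =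
      ((1 - q ^ Suc k) * gauss q n (Suc k)) * (qpoch q q (n - Suc k) * qpoch q q k)"
    by (simp add: qpoch_Suc algebra_simps)
  also have "\<dots> = gauss q n k * (qpoch q q (n - k) * qpoch q q k)"
    using Suc.prems by (subst gauss_absorb) (simp_all add: d qpoch_Suc algebra_simps)
  finally show ?case using Suc by simp
qed simp

section \<open>Coefficients indexed by their distance from the centre\<close>

text \<open>The guard matters: for k > n truncated subtraction would turn the lower index into 0 and
  give the value 1.\<close>

definition cgauss :: "complex \<Rightarrow> nat \<Rightarrow> nat \<Rightarrow> complex" where
  "cgauss q n k = (if k \<le> n then gauss q (2 * n) (n - k) else 0)"

text \<open>Row 2n+2 is reduced to row 2n by one use of each Pascal rule. The factor
  \<open>q ^ j\<close> absorbs the exponent n+1-j, so no subtraction remains in the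
  exponents.\<close>

lemma cgauss_Suc:
  assumes "j \<ge> 1"
  shows "q ^ j * cgauss q (Suc n) j = q ^ j * (1 + q ^ (2 * n + 1)) * cgauss q n j +
    q ^ (n + 1) * cgauss q n (j - 1) + q ^ (n + 1 + 2 * j) * cgauss q n (j + 1)"
proof -
  \<comment> \<open>Only in the last case are all three neighbours of row 2n inside the guard; there
    i = n-j-1 is the smallest lower index.\<close>
  consider "j > Suc n" | "j = Suc n" | "j = n" | i where "n = Suc (j + i)"
    by (metis less_imp_Suc_add linorder_neqE_nat not_less_eq)
  then show ?thesis
  proof cases
    case 3
    then obtain m where n: "n = Suc m" using assms by (cases n) auto
    have "gauss q (2 * Suc n) 1 = 1 + q * gauss q (Suc (2 * n)) 1"
      by simp
    also have "gauss q (Suc (2 * n)) 1 = q ^ (2 * n) + gauss q (2 * n) 1"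
      using gauss_Suc_Suc'[of 0 "2 * n" q] by simp
    finally have "gauss q (2 * Suc n) 1 = 1 + q ^ (2 * n + 1) + q * gauss q (2 * n) 1"
      by (simp add: algebra_simps)
    then show ?thesis using 3 n
      by (simp add: cgauss_def algebra_simps power_add)
  next
    case (4 i)
    have "gauss q (2 * Suc n) (Suc (Suc i)) =
        gauss q (Suc (2 * n)) (Suc i) + q ^ Suc (Suc i) * gauss q (Suc (2 * n)) (Suc (Suc i))"
      by simp
    also have "gauss q (Suc (2 * n)) (Suc i) =
        q ^ (2 * n - i) * gauss q (2 * n) i + gauss q (2 * n) (Suc i)"
      using 4 by (intro gauss_Suc_Suc') auto
    also have "gauss q (Suc (2 * n)) (Suc (Suc i)) =
        q ^ (2 * n - Suc i) * gauss q (2 * n) (Suc i) + gauss q (2 * n) (Suc (Suc i))"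
      using 4 by (intro gauss_Suc_Suc') auto
    finally have *: "gauss q (2 * Suc n) (Suc (Suc i)) =
        q ^ (2 * n - i) * gauss q (2 * n) i +
        (1 + q ^ (Suc (Suc i) + (2 * n - Suc i))) * gauss q (2 * n) (Suc i) +
        q ^ Suc (Suc i) * gauss q (2 * n) (Suc (Suc i))"
      by (simp only: power_add distrib_left distrib_right mult_1_left mult.assoc add.assoc)
    have e: "2 * n - i = n + 1 + j" "Suc (Suc i) + (2 * n - Suc i) = 2 * n + 1"
      "Suc n - j = Suc (Suc i)" "n - j = Suc i" "n - (j - 1) = Suc (Suc i)" "n - (j + 1) = i"
      "j + Suc (Suc i) = n + 1"
      using 4 assms by auto
    have "q ^ j * q ^ Suc (Suc i) = q ^ (n + 1)"
      by (simp only: power_add[symmetric] e)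
    moreover have "q ^ j * q ^ (n + 1 + j) = q ^ (n + 1 + 2 * j)"
      by (simp add: power_add mult_2)
    ultimately    show ?thesis
      using 4 *[unfolded e] unfolding cgauss_def e by (simp add: ring_distribs mult.assoc[symmetric] del: power_Suc gauss.simps)
  qed (auto simp: cgauss_def)
qed

lemma cgauss_absorb:
  assumes "k < n"
  shows "(1 - q ^ (n - k)) * cgauss q n k = (1 - q ^ (n + k + 1)) * cgauss q n (k + 1)"
proof -
  obtain i where n: "n = Suc (k + i)" using assms less_imp_Suc_add by blast
  then have e: "2 * n - i = n + k + 1" "n - k = Suc i" "n - (k + 1) = i" "i \<le> 2 * n" "k \<le> n" "k + 1 \<le> n"
    by auto
  show ?thesis
    using gauss_absorb[OF e(4), of q] e(5,6) unfolding cgauss_def e by simp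
qed

text \<open>
  Coefficient form of a three-step functional equation \<open>A(xq) = - x\<^sup>3 A(x) + \<dots>\<close> for the
  partial sums \<open>A(x)\<close> of \<open>\<Sum> q\<^sup>n (x)\<^sub>n (q/x)\<^sub>n\<close>.
\<close>
lemma cgauss_step:
  assumes "q \<noteq> 0"
  shows "q ^ n * (q ^ (4 * k + 6) * cgauss q n (k + 3) - cgauss q n k) =
    (q ^ (3 * k + 3) * cgauss q (Suc n) (k + 2) - q ^ k * cgauss q (Suc n) (k + 1)) -
    (q ^ (3 * k + 3) * cgauss q n (k + 2) - q ^ k * cgauss q n (k + 1))"
proof -
  define x y where "x = q ^ n" and "y = q ^ k"
  have ne: "y \<noteq> 0" using assms by (simp add: y_def)
  have e: "q ^ (n + 1) = x * q" "q ^ (2 * n + 1) = x\<^sup>2 * q" "q ^ (k + 1) = y * q"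
    "q ^ (k + 2) = y * q\<^sup>2" "q ^ (n + 1 + 2 * (k + 1)) = x * y\<^sup>2 * q ^ 3"
    "q ^ (n + 1 + 2 * (k + 2)) = x * y\<^sup>2 * q ^ 5" "q ^ (4 * k + 6) = y ^ 4 * q ^ 6"
    "q ^ (3 * k + 3) = y ^ 3 * q ^ 3" "q ^ (n + k + 2) = x * y * q\<^sup>2"
    unfolding x_def y_def power_mult[symmetric] power_add[symmetric] power_Suc[symmetric] power_Suc2[symmetric]
    by (simp_all add: power_mult[symmetric] power_add power_mult_distrib
        power2_eq_square power3_eq_cube mult_2 numeral_eq_Suc algebra_simps)
  have s1: "y * q * cgauss q (Suc n) (k + 1) = y * q * (1 + x\<^sup>2 * q) * cgauss q n (k + 1) +
      x * q * cgauss q n k + x * y\<^sup>2 * q ^ 3 * cgauss q n (k + 2)"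
    using cgauss_Suc[of "k + 1" q n] unfolding e by (simp add: e numeral_eq_Suc)
  have s2: "y * q\<^sup>2 * cgauss q (Suc n) (k + 2) = y * q\<^sup>2 * (1 + x\<^sup>2 * q) * cgauss q n (k + 2) +
      x * q * cgauss q n (k + 1) + x * y\<^sup>2 * q ^ 5 * cgauss q n (k + 3)"
    using cgauss_Suc[of "k + 2" q n] unfolding e by (simp add: e numeral_eq_Suc)
  \<comment> \<open>\<open>cgauss_absorb\<close> at k+1, multiplied by \<open>q ^ (k + 1)\<close>.
    For k+1 = n the left factor and \<open>cgauss q n (k + 2)\<close> vanish, beyond that both
    coefficients do.\<close>
  have a: "(y * q - x) * cgauss q n (k + 1) = (y * q - x * y\<^sup>2 * q ^ 3) * cgauss q n (k + 2)"
  proof (cases "k + 1 \<le> n")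
    case True
    have "q ^ (k + 1) * q ^ (n - (k + 1)) = q ^ n"
      using True by (simp only: power_add[symmetric] le_add_diff_inverse)
    then have x: "y * q * q ^ (n - (k + 1)) = x" unfolding e by (simp only: x_def)
    have "(y * q - x) * cgauss q n (k + 1) = y * q * ((1 - q ^ (n - (k + 1))) * cgauss q n (k + 1))"
      unfolding x[symmetric] by (simp add: algebra_simps)
    also have "(1 - q ^ (n - (k + 1))) * cgauss q n (k + 1) = (1 - x * y * q\<^sup>2) * cgauss q n (k + 2)"
    proof (cases "k + 1 = n")
      case True then show ?thesis by (simp add: cgauss_def)
    next
      case False
      with True show ?thesis using cgauss_absorb[of "k + 1" n q] e by simp
    qed
    finally show ?thesis
      by (simp add: algebra_simps power2_eq_square power3_eq_cube)
  next
    case False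
    then show ?thesis by (simp add: cgauss_def)
  qed
  \<comment> \<open>The extra nonzero factor produces the left sides of \<open>s1\<close> and
    \<open>s2\<close>, which eliminate row n+1; \<open>a\<close> settles the rest.\<close>
  have "y * q\<^sup>2 * (x * (y ^ 4 * q ^ 6 * cgauss q n (k + 3) - cgauss q n k)) =
    y * q\<^sup>2 * ((y ^ 3 * q ^ 3 * cgauss q (Suc n) (k + 2) - y * cgauss q (Suc n) (k + 1)) -
    (y ^ 3 * q ^ 3 * cgauss q n (k + 2) - y * cgauss q n (k + 1)))"
    using s1 s2 a by algebra
  then show ?thesis
    using ne assms unfolding e x_def[symmetric] y_def[symmetric] by simp
qed

section \<open>The sums over \<open>n\<close> at a root of unity\<close>

definition cgauss_sum :: "complex \<Rightarrow> nat \<Rightarrow> nat \<Rightarrow> complex" where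
  "cgauss_sum q N k = (\<Sum>n<N. q ^ n * cgauss q n k)"

text \<open>\<open>cgauss_step\<close> telescopes over n; the lower boundary terms vanish because
  \<open>cgauss q 0 m\<close> is 0 for m > 0.\<close>

lemma cgauss_sum_rec:
  assumes "q \<noteq> 0"
  shows "q ^ (4 * k + 6) * cgauss_sum q N (k + 3) - cgauss_sum q N k =
    q ^ (3 * k + 3) * cgauss q N (k + 2) - q ^ k * cgauss q N (k + 1)"
proof (induction N)
  case 0
  then show ?case by (simp add: cgauss_sum_def cgauss_def)
next
  case (Suc N)
  have "cgauss_sum q (Suc N) m = cgauss_sum q N m + q ^ N * cgauss q N m" for m
    by (simp add: cgauss_sum_def)
  then have "q ^ (4 * k + 6) * cgauss_sum q (Suc N) (k + 3) - cgauss_sum q (Suc N) k =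
      (q ^ (4 * k + 6) * cgauss_sum q N (k + 3) - cgauss_sum q N k) +
      q ^ N * (q ^ (4 * k + 6) * cgauss q N (k + 3) - cgauss q N k)"
    by (simp add: algebra_simps)
  then show ?case
    unfolding Suc cgauss_step[OF assms] by simp
qed

lemma primitive_unity_root_power_eq_1:
  assumes "primitive_unity_root N q"
  shows "q ^ (N * m) = 1"
  using assms by (simp add: primitive_unity_root_def power_mult)

lemma primitive_unity_root_nonzero:
  assumes "primitive_unity_root N q"
  shows "q \<noteq> 0"
  using assms by (auto simp: primitive_unity_root_def zero_power)

text \<open>In \<open>gauss_absorb\<close> for row 2N the factor \<open>1 - q ^ Suc i\<close> is
  nonzero below N. At i = 0 the other side contains \<open>1 - q ^ (2 * N)\<close> = 0, and the zero
  propagates upwards.\<close>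

lemma gauss_unity_root_eq_0:
  assumes "primitive_unity_root N q" and "0 < i" and "i < N"
  shows "gauss q (2 * N) i = 0"
  using assms(2,3)
proof (induction i)
  case (Suc i)
  have "q ^ Suc i \<noteq> 1"
    using assms(1) Suc.prems by (auto simp: primitive_unity_root_def simp del: power_Suc)
  moreover have "(1 - q ^ Suc i) * gauss q (2 * N) (Suc i) = 0"
  proof (cases "i = 0")
    case True
    then show ?thesis
      using gauss_absorb[of 0 "2 * N" q] primitive_unity_root_power_eq_1[OF assms(1), of 2]
      by (simp add: mult.commute)
  next
    case False
    then show ?thesis
      using gauss_absorb[of i "2 * N" q] Suc by simp
  qed
  ultimately show ?case by auto
qed simp

lemma cgauss_unity_root:
  assumes "primitive_unity_root N q" and "k > 0"
  shows "cgauss q N k = of_bool (k = N)"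
  using gauss_unity_root_eq_0[OF assms(1), of "N - k"] assms(2)
  by (auto simp: cgauss_def)

section \<open>Solving the three-step recurrence\<close>

text \<open>The partial sums of \<^const>\<open>alpha\<close>; see \<open>alpha_0\<close> and \<open>alpha_Suc\<close>.\<close>
fun alpha_sum :: "complex \<Rightarrow> nat \<Rightarrow> complex" where
  "alpha_sum q 0 = 1"
| "alpha_sum q (Suc 0) = - q"
| "alpha_sum q (Suc (Suc 0)) = 0"
| "alpha_sum q (Suc (Suc (Suc j))) = q ^ (2 * j + 5) * alpha_sum q j"

text \<open>The recurrence is run downwards from k = N-1; the normalising factor
  \<open>q ^ (k\<^sup>2)\<close> makes its coefficients depend on j alone.\<close>

lemma cgauss_sum_eq_alpha_sum:
  assumes "primitive_unity_root N q"
  shows "k + j = N - 1 \<Longrightarrow> q ^ (k\<^sup>2) * cgauss_sum q N k = alpha_sum q j"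
proof (induction j arbitrary: k rule: less_induct)
  case (less j)
  note q0 = primitive_unity_root_nonzero[OF assms]
  have N: "q ^ N = 1" "N > 0" using assms by (auto simp: primitive_unity_root_def)
  have z: "cgauss_sum q N m = 0" if "m \<ge> N" for m
    unfolding cgauss_sum_def using that by (intro sum.neutral) (auto simp: cgauss_def)
  have rec: "cgauss_sum q N k = q ^ (4 * k + 6) * cgauss_sum q N (k + 3) -
      q ^ (3 * k + 3) * of_bool (k + 2 = N) + q ^ k * of_bool (k + 1 = N)"
    using cgauss_sum_rec[OF q0, of k N] by (simp add: cgauss_unity_root[OF assms] algebra_simps)
  \<comment> \<open>For j < 3 the sum at k+3 is empty of nonzero terms by \<open>z\<close>, so only
    the boundary terms remain: they give 1, -q and 0.\<close>
  consider "j = 0" | "j = 1" | "j = 2" | i where "j = Suc (Suc (Suc i))"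
    by (metis One_nat_def Suc_1 not0_implies_Suc)
  then show ?case
  proof cases
    case 1
    then have k: "N = k + 1" using less.prems N by simp
    then have e: "N * k = k\<^sup>2 + k" by (simp add: power2_eq_square)
    have "q ^ (k\<^sup>2) * cgauss_sum q N k = q ^ (N * k)"
      unfolding e using rec z[of "k + 3"] k by (simp add: power_add)
    then show ?thesis using 1 primitive_unity_root_power_eq_1[OF assms] by simp
  next
    case 2
    then have k: "N = k + 2" using less.prems N by simp
    have e: "k\<^sup>2 + (3 * k + 3) = N * (k + 1) + 1" by (simp add: k power2_eq_square)
    have "q ^ (k\<^sup>2) * cgauss_sum q N k = - (q ^ (k\<^sup>2 + (3 * k + 3)))"
      using rec z[of "k + 3"] k by (simp add: power_add right_diff_distrib)
    also have "\<dots> = - q"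
      unfolding e power_add primitive_unity_root_power_eq_1[OF assms] by simp
    finally show ?thesis using 2 by simp
  next
    case 3
    then have "N = k + 3" using less.prems N by simp
    then show ?thesis using rec z[of "k + 3"] 3 by (simp add: numeral_2_eq_2)
  next
    case (4 i)
    then have N': "N = k + i + 4" and "k + 3 + i = N - 1" using less.prems N by auto
    then have IH: "q ^ ((k + 3)\<^sup>2) * cgauss_sum q N (k + 3) = alpha_sum q i"
      using 4 by (intro less.IH) auto
    \<comment> \<open>Modulo N = k+i+4 the exponents agree; this is the origin of 2j+5 in
      \<open>alpha_sum\<close>.\<close>
    have e: "(2 * i + 5) + (k + 3)\<^sup>2 = N * 2 + (k\<^sup>2 + (4 * k + 6))"
      by (simp add: N' power2_eq_square algebra_simps)
    have "q ^ (k\<^sup>2) * cgauss_sum q N k = q ^ (k\<^sup>2 + (4 * k + 6)) * cgauss_sum q N (k + 3)"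
      using rec N' by (simp add: power_add)
    also have "q ^ (k\<^sup>2 + (4 * k + 6)) = q ^ (N * 2 + (k\<^sup>2 + (4 * k + 6)))"
      unfolding power_add[of q "N * 2"] primitive_unity_root_power_eq_1[OF assms] by simp
    finally show ?thesis
      unfolding e[symmetric] 4 alpha_sum.simps IH[symmetric] power_add by simp
  qed
qed

text \<open>The exponents grow by 6r+5 and 6r+7, the values of 2j+5 at j = 3r and j = 3r+1; the
  third class starts at 0 and stays there.\<close>

lemma alpha_sum_eq:
  "alpha_sum q (3 * r) = q ^ (3 * r\<^sup>2 + 2 * r)"
  "alpha_sum q (3 * r + 1) = - (q ^ (3 * r\<^sup>2 + 4 * r + 1))"
  "alpha_sum q (3 * r + 2) = 0"
proof (induction r)
  case (Suc r)
  have e: "3 * Suc r = Suc (Suc (Suc (3 * r)))" "3 * Suc r + 1 = Suc (Suc (Suc (3 * r + 1)))"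
    "3 * Suc r + 2 = Suc (Suc (Suc (3 * r + 2)))" by simp_all
  {
    case 1
    show ?case unfolding e using Suc
      by (simp add: power_add[symmetric] power2_eq_square algebra_simps del: power_Suc)
  next
    case 2
    show ?case unfolding e using Suc
      by (simp add: power_add[symmetric] power2_eq_square algebra_simps del: power_Suc)
  next
    case 3
    show ?case unfolding e using Suc by simp
  }
qed simp_all

lemma alpha_0: "alpha q 0 = alpha_sum q 0"
  by (simp add: alpha_def)

text \<open>Each third partial sum is 0, so \<open>alpha\<close> has two terms only at indices 3r+1
  and a single one elsewhere.\<close>

lemma alpha_Suc: "alpha q (Suc j) = alpha_sum q (Suc j) - alpha_sum q j"
proof -
  obtain r where "j = 3 * r \<or> j = 3 * r + 1 \<or> j = 3 * r + 2"
    by (metis One_nat_def Suc_1 add.commute add_0 less_2_cases less_Suc_eq mod_less_divisor mult_div_mod_eq numeral_3_eq_3 zero_less_Suc)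
  then consider "j = 3 * r" | "j = 3 * r + 1" | "j = 3 * r + 2" by blast
  then show ?thesis
  proof cases
    case 1
    then show ?thesis using alpha_cases(3)[of q r] alpha_sum_eq[of q r] by simp
  next
    case 2
    \<comment> \<open>The class 3r-1 is used with r+1 in place of r.\<close>
    have e: "Suc j = 3 * Suc r - 1" "3 * (Suc r)\<^sup>2 - 2 * Suc r = 3 * r\<^sup>2 + 4 * r + 1"
      using 2 by (simp_all add: power2_eq_square)
    show ?thesis using alpha_cases(1)[of "Suc r" q, folded e(1), unfolded e(2)] alpha_sum_eq[of q r] 2
      by (simp del: power_Suc)
  next
    case 3
    have e: "Suc j = 3 * Suc r" using 3 by simp
    have "alpha q (Suc j) = alpha_sum q (Suc j)"
      unfolding e using alpha_cases(2)[of q "Suc r"] alpha_sum_eq(1)[of q "Suc r"] by (simp only:)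
    then show ?thesis using alpha_sum_eq(3)[of q r] 3 by simp
  qed
qed

section \<open>The Bailey chain\<close>

text \<open>\<open>qpoch q q n\<close> times the beta side of the iterated Bailey pair: level 0 is
  the unit pair, and each level is the Bailey lemma for a = q with both parameters sent to
  infinity.\<close>

fun chain_sum :: "complex \<Rightarrow> nat \<Rightarrow> nat \<Rightarrow> complex" where
  "chain_sum q 0 n = of_bool (n = 0)"
| "chain_sum q (Suc p) n = (\<Sum>r\<le>n. q ^ (r * (r + 1)) * gauss q n r * chain_sum q p r)"

lemma chain_sum_1: "chain_sum q (Suc 0) n = 1"
proof -
  have "chain_sum q (Suc 0) n = (\<Sum>r\<in>{0}. q ^ (r * (r + 1)) * gauss q n r * of_bool (r = 0))"
    unfolding chain_sum.simps by (intro sum.mono_neutral_right) auto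
  then show ?thesis by simp
qed

text \<open>A limiting case of q-Chu-Vandermonde. The Pascal rule turns the sum for m+1 and c into
  that for m and c+1, so c varies in the induction.\<close>

lemma q_Vandermonde:
  assumes nz: "\<And>n. qpoch q q n \<noteq> 0"
  shows "(\<Sum>j\<le>m. q ^ (j * j + c * j) * gauss q m j / qpoch q q (c + j)) = 1 / qpoch q q (c + m)"
proof (induction m arbitrary: c)
  case (Suc m)
  let ?P = "qpoch q q"
  \<comment> \<open>The Pascal rule splits the term at j+1 into \<open>?h j\<close> and
    \<open>?g (Suc j)\<close>.\<close>
  let ?g = "\<lambda>j. q ^ (j * j + (c + 1) * j) * gauss q m j / ?P (c + j)"
  let ?h = "\<lambda>j. q ^ (j * j + (c + 1) * j + (j + 1 + c)) * gauss q m j / ?P (c + 1 + j)"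
  have "(\<Sum>j\<le>Suc m. q ^ (j * j + c * j) * gauss q (Suc m) j / ?P (c + j)) =
      ?g 0 + (\<Sum>j\<le>m. ?h j + ?g (Suc j))"
    unfolding sum.atMost_Suc_shift
    by (simp add: distrib_left add_divide_distrib power_add mult_ac)
  also have "\<dots> = (\<Sum>j\<le>m. ?h j) + (\<Sum>j\<le>Suc m. ?g j)"
    unfolding sum.atMost_Suc_shift by (simp add: sum.distrib)
  also have "\<dots> = (\<Sum>j\<le>m. ?h j + ?g j)"
    by (simp add: sum.distrib gauss_eq_0)
  also have "\<dots> = (\<Sum>j\<le>m. q ^ (j * j + (c + 1) * j) * gauss q m j / ?P ((c + 1) + j))"
  proof (intro sum.cong refl)
    fix j
    have P: "?P (c + 1 + j) = ?P (c + j) * (1 - q ^ (j + 1 + c))"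
      by (simp add: qpoch_Suc power_add mult_ac)
    have ne: "1 - q ^ (j + 1 + c) \<noteq> 0" using nz[of "c + 1 + j"] unfolding P by auto
    \<comment> \<open>Over the common denominator, \<open>?g\<close> contributes 1-u and
      \<open>?h\<close> contributes u.\<close>
    define u where "u = q ^ (j + 1 + c)"
    show "?h j + ?g j = q ^ (j * j + (c + 1) * j) * gauss q m j / ?P ((c + 1) + j)"
      using ne nz[of "c + j"] unfolding P power_add[of q "j * j + (c + 1) * j"] u_def[symmetric]
      by (simp add: field_simps)
  qed
  also have "\<dots> = 1 / ?P (c + 1 + m)" by (rule Suc.IH)
  finally show ?case by simp
qed simp

lemma sum_triangle_shift:
  fixes f :: "nat \<Rightarrow> nat \<Rightarrow> 'a :: comm_monoid_add"
  shows "(\<Sum>r\<le>n. \<Sum>k\<le>r. f r k) = (\<Sum>k\<le>n. \<Sum>j\<le>n - k. f (k + j) k)"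
  unfolding sum.Sigma[OF finite_atMost ballI[OF finite_atMost]]
  by (rule sum.reindex_bij_witness[where i = "\<lambda>(k, j). (k + j, k)" and j = "\<lambda>(r, k). (k, r - k)"]) auto

text \<open>
  The \<open>\<alpha>\<close>-side of the \<open>p\<close>-fold iterated unit Bailey pair relative to \<open>a = q\<close>, without its factor
  \<open>(1 - q\<^bsup>2k+1\<^esup>) / (1 - q)\<close>.
\<close>
definition bailey_alpha :: "complex \<Rightarrow> nat \<Rightarrow> nat \<Rightarrow> complex" where
  "bailey_alpha q p k = (-1) ^ k * q ^ ((k choose 2) + p * (k\<^sup>2 + k))"

text \<open>A closed form for every partial sum makes the orthogonality relation inductive: at K = n
  > 0 the factor \<open>1 - q ^ (n - K)\<close> kills the whole sum.\<close>

lemma unit_bailey_pair_partial_sum: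
  assumes nz: "\<And>n. qpoch q q n \<noteq> 0" and "K \<le> n"
  shows "(1 - q ^ n) * (\<Sum>k\<le>K. bailey_alpha q 0 k * (1 - q ^ (2 * k + 1)) /
      (qpoch q q (n - k) * qpoch q q (n + k + 1))) =
    (-1) ^ K * q ^ (K + 1 choose 2) * (1 - q ^ (K + 1)) * (1 - q ^ (n - K)) /
      (qpoch q q (n - K) * qpoch q q (n + K + 1))"
  using assms(2)
proof (induction K)
  case 0
  then show ?case by (simp add: bailey_alpha_def mult_ac numeral_2_eq_2)
next
  case (Suc K)
  let ?P = "qpoch q q"
  obtain d where n: "n = Suc (K + d)" using Suc.prems by (metis Suc_le_D add_Suc le_Suc_ex)
  \<comment> \<open>\<open>w\<close> is the signed prefactor of the K-th partial sum and also minus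
    the next \<open>bailey_alpha\<close>, so the step reduces to a polynomial identity in x, y and
    q.\<close>
  define x y w where "x = q ^ (K + 1)" and "y = q ^ d" and "w = (-1) ^ K * q ^ (K + 1 choose 2)"
  have e: "n - K = Suc d" "n - Suc K = d" "n + Suc K + 1 = Suc (n + K + 1)" using n by auto
  have P: "?P (Suc d) = ?P d * (1 - q * y)" "?P (Suc (n + K + 1)) = ?P (n + K + 1) * (1 - x * x * y * q)"
    unfolding qpoch_Suc by (simp_all add: n x_def y_def power_add mult_ac)
  have ne: "1 - q * y \<noteq> 0" "1 - x * x * y * q \<noteq> 0" "?P d \<noteq> 0" "?P (n + K + 1) \<noteq> 0"
    using nz[of "Suc d"] nz[of "Suc (n + K + 1)"] nz unfolding P by auto
  have a: "bailey_alpha q 0 (Suc K) = - w" by (simp add: bailey_alpha_def w_def)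
  have "(Suc K + 1 choose 2) = (K + 1) + (K + 1 choose 2)"
    by (simp add: numeral_2_eq_2)
  then have w: "(-1) ^ Suc K * q ^ (Suc K + 1 choose 2) = - (x * w)"
    unfolding x_def w_def by (simp only: power_add) simp
  have pw: "q ^ n = x * y" "q ^ (2 * Suc K + 1) = x * x * q" "q ^ Suc d = q * y" "q ^ (Suc K + 1) = x * q"
    unfolding x_def y_def by (simp_all add: n power_add mult_2)
  have "(1 - q ^ n) * (\<Sum>k\<le>Suc K. bailey_alpha q 0 k * (1 - q ^ (2 * k + 1)) /
      (?P (n - k) * ?P (n + k + 1))) =
      w * (1 - x) * (1 - q * y) / (?P (Suc d) * ?P (n + K + 1)) +
      (1 - x * y) * (- w * (1 - x * x * q) / (?P d * ?P (Suc (n + K + 1))))"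
    using Suc.IH Suc.prems unfolding sum.atMost_Suc distrib_left e a pw(2,3)
    by (simp add: w_def x_def pw(1)[unfolded x_def] pw(3) mult_ac)
  also have "\<dots> = w * ((1 - x) * (1 - x * x * y * q) - (1 - x * y) * (1 - x * x * q)) /
      (?P d * ?P (Suc (n + K + 1)))"
  proof -
    have "w * a * b / (A * b * B) + c * (- w * d / (A * (B * e))) = w * (a * e - c * d) / (A * (B * e))"
      if "A \<noteq> 0" "B \<noteq> 0" "b \<noteq> 0" "e \<noteq> 0" for a b c d e A B :: complex
      using that by (simp add: field_simps)
    then show ?thesis unfolding P using ne by blast
  qed
  also have "(1 - x) * (1 - x * x * y * q) - (1 - x * y) * (1 - x * x * q) = - x * (1 - x * q) * (1 - y)"
    by (simp add: algebra_simps)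
  finally show ?case
    unfolding e w pw(4) y_def[symmetric] by (simp add: mult_ac)
qed

text \<open>The Bailey lemma: after exchanging sums and putting r = k+j, the inner sum over j is
  \<open>q_Vandermonde\<close> with c = 2k+1. The unit pair starts the induction.\<close>

lemma chain_sum_eq:
  assumes nz: "\<And>n. qpoch q q n \<noteq> 0"
  shows "chain_sum q p n = qpoch q q n * (\<Sum>k\<le>n. bailey_alpha q p k * (1 - q ^ (2 * k + 1)) /
    (qpoch q q (n - k) * qpoch q q (n + k + 1)))"
proof (induction p arbitrary: n)
  case 0
  show ?case
  proof (cases n)
    case 0
    then show ?thesis using nz[of 1] by (simp add: bailey_alpha_def qpoch_Suc numeral_2_eq_2)
  next
    case (Suc m)
    then have "1 - q ^ n \<noteq> 0" using nz[of n] by (auto simp: qpoch_Suc)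
    then show ?thesis using unit_bailey_pair_partial_sum[OF nz, of n n] Suc by simp
  qed
next
  case (Suc p)
  let ?P = "qpoch q q"
  let ?A = "\<lambda>p k. bailey_alpha q p k * (1 - q ^ (2 * k + 1))"
  have A: "q ^ (k * k + k) * ?A p k = ?A (Suc p) k" for k
    by (simp add: bailey_alpha_def power_add power2_eq_square)
  have g: "gauss q n r * ?P r = ?P n / ?P (n - r)" if "r \<le> n" for n r
    using gauss_qpoch[OF that, of q] nz[of "n - r"] by (simp add: field_simps)
  have "chain_sum q (Suc p) n =
      (\<Sum>r\<le>n. q ^ (r * (r + 1)) * (gauss q n r * ?P r) * (\<Sum>k\<le>r. ?A p k / (?P (r - k) * ?P (r + k + 1))))"
    by (simp add: Suc.IH mult_ac)
  also have "\<dots> = (\<Sum>r\<le>n. \<Sum>k\<le>r. ?P n * (?A p k * (q ^ (r * (r + 1)) /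
      (?P (n - r) * ?P (r - k) * ?P (r + k + 1)))))"
  proof (intro sum.cong refl)
    fix r assume "r \<in> {..n}"
    then have *: "gauss q n r * ?P r = ?P n / ?P (n - r)" by (simp add: g)
    show "q ^ (r * (r + 1)) * (gauss q n r * ?P r) * (\<Sum>k\<le>r. ?A p k / (?P (r - k) * ?P (r + k + 1))) =
        (\<Sum>k\<le>r. ?P n * (?A p k * (q ^ (r * (r + 1)) / (?P (n - r) * ?P (r - k) * ?P (r + k + 1)))))"
      unfolding * sum_distrib_left by (simp add: mult_ac)
  qed
  also have "\<dots> = (\<Sum>k\<le>n. \<Sum>j\<le>n - k. ?P n * (?A p k * (q ^ ((k + j) * (k + j + 1)) /
      (?P (n - (k + j)) * ?P (k + j - k) * ?P (k + j + k + 1)))))"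
    by (rule sum_triangle_shift)
  also have "\<dots> = (\<Sum>k\<le>n. ?P n * (?A p k * (\<Sum>j\<le>n - k. q ^ ((k + j) * (k + j + 1)) /
      (?P (n - (k + j)) * ?P (k + j - k) * ?P (k + j + k + 1)))))"
    by (simp only: sum_distrib_left)
  also have "\<dots> = (\<Sum>k\<le>n. ?P n * (?A p k * (q ^ (k * k + k) / (?P (n - k) * ?P (n + k + 1)))))"
  proof (intro sum.cong refl arg_cong2[where f = "(*)"])
    fix k assume "k \<in> {..n}"
    then obtain m where n: "n = k + m" using le_Suc_ex by auto
    have "(\<Sum>j\<le>n - k. q ^ ((k + j) * (k + j + 1)) /
        (?P (n - (k + j)) * ?P (k + j - k) * ?P (k + j + k + 1))) =
      (\<Sum>j\<le>m. q ^ (k * k + k) / ?P m * (q ^ (j * j + (2 * k + 1) * j) * gauss q m j / ?P (2 * k + 1 + j)))"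
    proof (intro sum.cong)
      fix j assume "j \<in> {..m}"
      then have "gauss q m j = ?P m / (?P (m - j) * ?P j)"
        using gauss_qpoch[of j m q] nz[of j] nz[of "m - j"] by (simp add: field_simps)
      moreover have "(k + j) * (k + j + 1) = (k * k + k) + (j * j + (2 * k + 1) * j)"
        "n - (k + j) = m - j" "k + j - k = j" "k + j + k + 1 = 2 * k + 1 + j"
        using n by (simp_all add: algebra_simps)
      ultimately show "q ^ ((k + j) * (k + j + 1)) /
          (?P (n - (k + j)) * ?P (k + j - k) * ?P (k + j + k + 1)) =
        q ^ (k * k + k) / ?P m * (q ^ (j * j + (2 * k + 1) * j) * gauss q m j / ?P (2 * k + 1 + j))"
        using nz[of m] by (simp only: power_add) simp
    qed (simp add: n)
    also have "\<dots> = q ^ (k * k + k) / ?P m * (1 / ?P (2 * k + 1 + m))"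
      unfolding sum_distrib_left[symmetric] q_Vandermonde[OF nz] ..
    also have "2 * k + 1 + m = n + k + 1" using n by simp
    finally show "(\<Sum>j\<le>n - k. q ^ ((k + j) * (k + j + 1)) /
        (?P (n - (k + j)) * ?P (k + j - k) * ?P (k + j + k + 1))) =
      q ^ (k * k + k) / (?P (n - k) * ?P (n + k + 1))"
      using n by simp
  qed
  also have "\<dots> = ?P n * (\<Sum>k\<le>n. ?A (Suc p) k / (?P (n - k) * ?P (n + k + 1)))"
    unfolding A[symmetric] sum_distrib_left by (simp add: mult_ac)
  finally show ?case .
qed

text \<open>Removes the denominators, so that the expansion becomes polynomial in q.\<close>

lemma cgauss_diff:
  assumes nz: "\<And>n. qpoch q q n \<noteq> 0" and "k \<le> n"
  shows "qpoch q q (2 * n) * (1 - q ^ (2 * k + 1)) / (qpoch q q (n - k) * qpoch q q (n + k + 1)) =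
    cgauss q n k - q ^ (2 * k + 1) * cgauss q n (k + 1)"
proof -
  let ?P = "qpoch q q"
  define u v w where "u = q ^ (n + k + 1)" and "v = q ^ (n - k)" and "w = q ^ (2 * k + 1)"
  have "n - k + (2 * k + 1) = n + k + 1" using assms(2) by simp
  then have u: "u = v * w" unfolding u_def v_def w_def by (simp only: power_add[symmetric])
  have P: "?P (n + k + 1) = ?P (n + k) * (1 - u)"
    by (simp add: qpoch_Suc u_def)
  have ne: "1 - u \<noteq> 0" "?P (n + k) \<noteq> 0" "?P (n - k) \<noteq> 0"
    using nz[of "n + k + 1"] nz unfolding P by auto
  have "2 * n - (n - k) = n + k" using assms(2) by simp
  then have c0: "cgauss q n k = ?P (2 * n) / (?P (n - k) * ?P (n + k))"
    using gauss_qpoch[of "n - k" "2 * n" q] ne(2,3) assms(2) by (simp add: cgauss_def field_simps)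
  have "(1 - v) * cgauss q n k = (1 - u) * cgauss q n (k + 1)"
    using cgauss_absorb[of k n q] assms(2) unfolding u_def v_def
    by (cases "k = n") (auto simp: cgauss_def)
  then have c1: "cgauss q n (k + 1) = (1 - v) * cgauss q n k / (1 - u)"
    using ne(1) by (simp add: field_simps)
  have "?P (2 * n) * (1 - w) / (?P (n - k) * (?P (n + k) * (1 - u))) = cgauss q n k * ((1 - w) / (1 - u))"
    unfolding c0 by simp
  \<comment> \<open>Rests on u = v w; the quotient (1-v)/(1-u) is the ratio of the two neighbouring
    coefficients.\<close>
  also have "(1 - w) / (1 - u) = 1 - w * ((1 - v) / (1 - u))"
    using ne(1) u by (simp add: field_simps)
  finally show ?thesis
    unfolding P c1 w_def[symmetric] by (simp add: algebra_simps)
qed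

lemma chain_sum_cgauss_generic:
  assumes nz: "\<And>n. qpoch q q n \<noteq> 0"
  shows "qpoch (q ^ (n + 1)) q n * chain_sum q p n =
    (\<Sum>k\<le>n. bailey_alpha q p k * (cgauss q n k - q ^ (2 * k + 1) * cgauss q n (k + 1)))"
proof -
  have "qpoch (q ^ (n + 1)) q n * qpoch q q n = qpoch q q (2 * n)"
    using qpoch_add[of q q n n] by (simp add: mult_2 mult.commute[of "qpoch q q n"])
  then have "qpoch (q ^ (n + 1)) q n * chain_sum q p n = qpoch q q (2 * n) *
      (\<Sum>k\<le>n. bailey_alpha q p k * (1 - q ^ (2 * k + 1)) / (qpoch q q (n - k) * qpoch q q (n + k + 1)))"
    unfolding chain_sum_eq[OF nz] mult.assoc[symmetric] by simp
  also have "\<dots> = (\<Sum>k\<le>n. bailey_alpha q p k * (qpoch q q (2 * n) * (1 - q ^ (2 * k + 1)) /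
      (qpoch q q (n - k) * qpoch q q (n + k + 1))))"
    unfolding sum_distrib_left by (simp add: mult_ac)
  also have "\<dots> = (\<Sum>k\<le>n. bailey_alpha q p k * (cgauss q n k - q ^ (2 * k + 1) * cgauss q n (k + 1)))"
    using cgauss_diff[OF nz] by (intro sum.cong) auto
  finally show ?thesis .
qed

section \<open>Extension to the unit circle by continuity\<close>

lemma continuous_on_gauss: "continuous_on A (\<lambda>q. gauss q n k)"
proof (induction n arbitrary: k)
  case 0
  then show ?case by (cases k) auto
next
  case (Suc n)
  then show ?case by (cases k) (auto intro!: continuous_intros)
qed

lemma continuous_on_cgauss: "continuous_on A (\<lambda>q. cgauss q n k)"
  by (cases "k \<le> n") (auto simp: cgauss_def continuous_on_gauss)

lemma continuous_on_chain_sum: "continuous_on A (\<lambda>q. chain_sum q p n)"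
  by (induction p arbitrary: n) (auto intro!: continuous_intros continuous_on_gauss)

text \<open>Inside the open disc no \<open>qpoch z z n\<close> vanishes and the generic identity
  applies; both sides are continuous, hence agree on the closed disc, which contains the roots of
  unity.\<close>

lemma chain_sum_cgauss:
  assumes "norm q \<le> 1"
  shows "qpoch (q ^ (n + 1)) q n * chain_sum q p n =
    (\<Sum>k\<le>n. bailey_alpha q p k * (cgauss q n k - q ^ (2 * k + 1) * cgauss q n (k + 1)))"
proof -
  define h where "h q = qpoch (q ^ (n + 1)) q n * chain_sum q p n -
    (\<Sum>k\<le>n. bailey_alpha q p k * (cgauss q n k - q ^ (2 * k + 1) * cgauss q n (k + 1)))" for q
  have "h q = 0"
  proof (rule continuous_constant_on_closure[where f = h and S = "ball 0 1"])
    show "continuous_on (closure (ball 0 1)) h"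
      unfolding h_def qpoch_def bailey_alpha_def
      by (auto intro!: continuous_intros continuous_on_cgauss continuous_on_chain_sum)
    show "q \<in> closure (ball 0 1)" using assms by simp
    fix z :: complex assume z: "z \<in> ball 0 1"
    have "z ^ Suc n \<noteq> 1" for n
      using z power_eq_1_iff[of z "Suc n"] by auto
    then have "qpoch z z n \<noteq> 0" for n
      by (induction n) (auto simp: qpoch_Suc)
    then show "h z = 0"
      unfolding h_def using chain_sum_cgauss_generic[of z n p] by simp
  qed
  then show ?thesis by (simp add: h_def)
qed

section \<open>Sums over chains\<close>

definition chains_to :: "nat \<Rightarrow> nat \<Rightarrow> (nat \<Rightarrow> nat) set" where
  "chains_to p m = {f \<in> chains p. f p = m}"

lemma chains_le: "f \<in> chains p \<Longrightarrow> i \<in> {1..p} \<Longrightarrow> f i \<le> f p"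
  by (auto simp: chains_def intro: mono_onD)

lemma finite_chains_bounded: "finite {f \<in> chains p. f p < N}"
proof (rule finite_subset)
  show "finite ({1..p} \<rightarrow>\<^sub>E {..<N})" by (intro finite_PiE) auto
  show "{f \<in> chains p. f p < N} \<subseteq> {1..p} \<rightarrow>\<^sub>E {..<N}"
  proof
    fix f assume f: "f \<in> {f \<in> chains p. f p < N}"
    then have "f i < N" if "i \<in> {1..p}" for i
      using chains_le[of f p i] that by auto
    then show "f \<in> {1..p} \<rightarrow>\<^sub>E {..<N}"
      using f by (auto simp: chains_def PiE_iff)
  qed
qed

lemma finite_chains_to: "finite (chains_to p m)"
  by (rule finite_subset[OF _ finite_chains_bounded[of p "Suc m"]]) (auto simp: chains_to_def)

lemma chains_to_1: "chains_to (Suc 0) m = {\<lambda>i. if i = 1 then m else undefined}"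
proof -
  have "f = (\<lambda>i. if i = 1 then m else undefined)" if "f \<in> chains_to (Suc 0) m" for f
    using that by (intro ext) (simp add: chains_to_def chains_def PiE_iff extensional_def)
  moreover have "(\<lambda>i. if i = 1 then m else undefined) \<in> chains_to (Suc 0) m"
    by (simp add: chains_to_def chains_def PiE_iff extensional_def mono_on_def)
  ultimately show ?thesis by blast
qed

text \<open>Removing the top entry m leaves a chain whose new top r is at most m. The bound on p
  makes position p a genuine entry.\<close>

lemma sum_chains_to_Suc:
  assumes "p \<ge> 1"
  shows "(\<Sum>f\<in>chains_to (Suc p) m. F f) = (\<Sum>r\<le>m. \<Sum>f\<in>chains_to p r. F (f(Suc p := m)))"
proof -
  have "(\<Sum>f\<in>chains_to (Suc p) m. F f) =
      (\<Sum>(r, f)\<in>(SIGMA r:{..m}. chains_to p r). F (f(Suc p := m)))"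
  \<comment> \<open>The removed position is reset to \<open>undefined\<close> because chains are
    extensional functions.\<close>
  proof (rule sum.reindex_bij_witness[where i = "\<lambda>(r, f). f(Suc p := m)"
        and j = "\<lambda>g. (g p, g(Suc p := undefined))"])
    fix g assume g: "g \<in> chains_to (Suc p) m"
    have "g p \<le> m" using chains_le[of g "Suc p" p] g assms by (auto simp: chains_to_def)
    moreover have "g(Suc p := undefined) \<in> chains_to p (g p)"
      using g assms by (simp add: chains_to_def chains_def PiE_iff extensional_def mono_on_def le_Suc_eq)
    ultimately show "(g p, g(Suc p := undefined)) \<in> (SIGMA r:{..m}. chains_to p r)"
      by simp
    show "(case (g p, g(Suc p := undefined)) of (r, f) \<Rightarrow> f(Suc p := m)) = g"
      using g by (auto simp: chains_to_def)
    then show "(case (g p, g(Suc p := undefined)) of (r, f) \<Rightarrow> F (f(Suc p := m))) = F g"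
      by simp
  next
    fix x assume "x \<in> (SIGMA r:{..m}. chains_to p r)"
    then obtain r f where x: "x = (r, f)" "r \<le> m" "f \<in> chains p" "f p = r"
      by (auto simp: chains_to_def)
    then have ext: "f (Suc p) = undefined"
      by (auto simp: chains_def PiE_iff extensional_def)
    show "(\<lambda>g. (g p, g(Suc p := undefined))) (case x of (r, f) \<Rightarrow> f(Suc p := m)) = x"
      using x ext by auto
    have "f(Suc p := m) \<in> chains (Suc p)"
      unfolding chains_def
    proof (intro CollectI conjI mono_onI)
      show "f(Suc p := m) \<in> {1..Suc p} \<rightarrow>\<^sub>E UNIV"
        using x(3) by (auto simp: chains_def PiE_iff extensional_def)
      fix i l assume il: "i \<in> {1..Suc p}" "l \<in> {1..Suc p}" "i \<le> l"
      show "(f(Suc p := m)) i \<le> (f(Suc p := m)) l"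
      proof (cases "l = Suc p")
        case True
        then show ?thesis using il x(2,4) chains_le[OF x(3), of i] by (cases "i = Suc p") auto
      next
        case False
        then show ?thesis using il x(3) by (auto simp: chains_def mono_on_def)
      qed
    qed
    then show "(case x of (r, f) \<Rightarrow> f(Suc p := m)) \<in> chains_to (Suc p) m"
      using x by (simp add: chains_to_def)
  qed
  also have "\<dots> = (\<Sum>r\<le>m. \<Sum>f\<in>chains_to p r. F (f(Suc p := m)))"
    by (simp add: sum.Sigma finite_chains_to)
  finally show ?thesis .
qed

lemma qbinom_eq_gauss:
  assumes "primitive_unity_root N q" "n < N" "k \<le> n"
  shows "qbinom q n k = gauss q n k"
  using gauss_qpoch[OF assms(3), of q] qpoch_nonzero[OF assms(1)] assms
  by (simp add: qbinom_def field_simps)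

text \<open>The factor i = p is the only one that sees the top entry m, and it is the weight in the
  recursion of \<open>chain_sum\<close>. Since m < N, each \<open>qbinom\<close> is a
  \<open>gauss\<close>.\<close>

lemma sum_chains_to_eq_chain_sum:
  assumes "primitive_unity_root N q"
  shows "p \<ge> 1 \<Longrightarrow> m < N \<Longrightarrow>
    (\<Sum>f\<in>chains_to p m. \<Prod>i=1..p-1. q ^ (f i * (f i + 1)) * qbinom q (f (i + 1)) (f i)) = chain_sum q p m"
proof (induction p arbitrary: m rule: nat_induct_at_least)
  case base
  then show ?case using chain_sum_1[of q m] by (simp add: chains_to_1)
next
  case (Suc p)
  let ?w = "\<lambda>f i. q ^ (f i * (f i + 1)) * qbinom q (f (i + 1)) (f i)"
  have "(\<Sum>f\<in>chains_to (Suc p) m. \<Prod>i=1..Suc p - 1. ?w f i) =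
      (\<Sum>r\<le>m. \<Sum>f\<in>chains_to p r. \<Prod>i=1..Suc p - 1. ?w (f(Suc p := m)) i)"
    by (rule sum_chains_to_Suc) fact
  also have "\<dots> = (\<Sum>r\<le>m. \<Sum>f\<in>chains_to p r. q ^ (r * (r + 1)) * gauss q m r * (\<Prod>i=1..p - 1. ?w f i))"
  proof (intro sum.cong refl)
    fix r f assume r: "r \<in> {..m}" and f: "f \<in> chains_to p r"
    have "{1..Suc p - 1} = insert p {1..p - 1}" using Suc.hyps by auto
    then have "(\<Prod>i=1..Suc p - 1. ?w (f(Suc p := m)) i) =
        ?w (f(Suc p := m)) p * (\<Prod>i=1..p - 1. ?w (f(Suc p := m)) i)"
      using Suc.hyps by simp
    also have "?w (f(Suc p := m)) p = q ^ (r * (r + 1)) * gauss q m r"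
      using f r qbinom_eq_gauss[OF assms Suc.prems, of r] by (simp add: chains_to_def)
    also have "(\<Prod>i=1..p - 1. ?w (f(Suc p := m)) i) = (\<Prod>i=1..p - 1. ?w f i)"
      by (intro prod.cong) auto
    finally show "(\<Prod>i=1..Suc p - 1. ?w (f(Suc p := m)) i) =
        q ^ (r * (r + 1)) * gauss q m r * (\<Prod>i=1..p - 1. ?w f i)" .
  qed
  also have "\<dots> = (\<Sum>r\<le>m. q ^ (r * (r + 1)) * gauss q m r * chain_sum q p r)"
    using Suc.IH Suc.prems by (intro sum.cong) (simp_all flip: sum_distrib_left)
  finally show ?case by simp
qed

text \<open>Chains with top entry at least N contribute 0 by \<open>qpoch_zero\<close>; the finitely
  many others are grouped by their top entry.\<close>

lemma H4_eq_chain_sum: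
  assumes "primitive_unity_root N q" and "p \<ge> 1"
  shows "H4 p q = (\<Sum>n<N. q ^ n * (qpoch (q ^ (n + 1)) q n * chain_sum q p n))"
proof -
  let ?A = "{f \<in> chains p. f p < N}"
  have "H4 p q = infsum (H4_term p q) ?A"
    unfolding H4_def
  proof (rule infsum_cong_neutral)
    fix f assume "f \<in> chains p - ?A"
    then have "N \<le> f p" by auto
    then show "H4_term p q f = 0"
      using qpoch_zero[OF assms(1), of "f p"] by (simp add: H4_term_def)
  qed auto
  also have "\<dots> = (\<Sum>f\<in>?A. H4_term p q f)"
    by (rule infsum_finite) (rule finite_chains_bounded)
  also have "\<dots> = (\<Sum>n<N. \<Sum>f | f \<in> ?A \<and> f p = n. H4_term p q f)"
    by (rule sum.group[symmetric]) (auto simp: finite_chains_bounded)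
  also have "\<dots> = (\<Sum>n<N. q ^ n * (qpoch (q ^ (n + 1)) q n * chain_sum q p n))"
  proof (intro sum.cong refl)
    fix n assume n: "n \<in> {..<N}"
    then have "{f. f \<in> ?A \<and> f p = n} = chains_to p n" by (auto simp: chains_to_def)
    then have "(\<Sum>f | f \<in> ?A \<and> f p = n. H4_term p q f) = (\<Sum>f\<in>chains_to p n.
        q ^ n * qpoch (q ^ (n + 1)) q n *
        (\<Prod>i=1..p-1. q ^ (f i * (f i + 1)) * qbinom q (f (i + 1)) (f i)))"
      by (simp add: H4_term_def chains_to_def)
    then show "(\<Sum>f | f \<in> ?A \<and> f p = n. H4_term p q f) =
        q ^ n * (qpoch (q ^ (n + 1)) q n * chain_sum q p n)"
      using n sum_chains_to_eq_chain_sum[OF assms(1,2), of n]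
      by (simp add: sum_distrib_left[symmetric] del: Suc_eq_plus1)
  qed
  finally show ?thesis .
qed

section \<open>Reflection symmetry and conclusion\<close>

lemma two_times_choose_two: "2 * (n + 1 choose 2) = n * (n + 1)"
  by (induction n) (simp_all add: numeral_2_eq_2)

lemma primitive_unity_root_half:
  assumes "primitive_unity_root (2 * M) q"
  shows "q ^ M = -1"
proof -
  have "(q ^ M)\<^sup>2 = 1" "q ^ M \<noteq> 1"
    using assms by (auto simp: primitive_unity_root_def power_mult[symmetric] mult.commute)
  then show ?thesis by (simp add: power2_eq_1_iff)
qed

text \<open>The cofactor of \<open>alpha q k\<close> in the final sum, with \<open>p\<close>
  standing for the theorem's p-1.\<close>

definition weight :: "complex \<Rightarrow> nat \<Rightarrow> nat \<Rightarrow> complex" where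
  "weight q p k = (-1) ^ k * q ^ ((k + 1 choose 2) + p * (k\<^sup>2 + k))"

text \<open>With k = j+d one has k(k+1) - j(j+1) = N d, so the binomials differ by N d / 2. For even
  d this is a multiple of N; for odd d, N is even and the resulting -1 cancels the change of
  sign.\<close>

lemma weight_reflect:
  assumes q: "primitive_unity_root N q" and "j + k + 1 = N"
  shows "weight q p j = weight q p k"
  using assms(2)
proof (induction j k rule: linorder_wlog)
  case (le j k)
  then obtain d where k: "k = j + d" using le_Suc_ex by blast
  note N = primitive_unity_root_power_eq_1[OF q]
  have X: "p * (k\<^sup>2 + k) = N * (p * d) + p * (j\<^sup>2 + j)"
    using le k by (auto simp: power2_eq_square algebra_simps)
  have "(-1) ^ k * q ^ (k + 1 choose 2) = (-1) ^ j * q ^ (j + 1 choose 2)"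
  proof (cases "even d")
    case True
    then obtain e where d: "d = 2 * e" by auto
    have "2 * (k + 1 choose 2) = 2 * (N * e + (j + 1 choose 2))"
      unfolding distrib_left two_times_choose_two using le k d by (auto simp: algebra_simps)
    then have "(k + 1 choose 2) = N * e + (j + 1 choose 2)" by simp
    then show ?thesis using N[of e] True by (simp only: k power_add) simp
  next
    case False
    then have "even N" using le k by auto
    then obtain M where M: "N = 2 * M" by auto
    have qM: "q ^ (M * d) = -1"
      using primitive_unity_root_half[of M q] q M False by (simp add: power_mult)
    have "2 * (k + 1 choose 2) = N * d + 2 * (j + 1 choose 2)"
      unfolding two_times_choose_two using le k by (auto simp: algebra_simps)
    then have "(k + 1 choose 2) = M * d + (j + 1 choose 2)" using M by simp
    then show ?thesis using False qM by (simp only: k power_add) simp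
  qed
  then show ?case unfolding weight_def X power_add[of q _ "N * (p * d) + _"] power_add[of q "N * (p * d)"] N
    by (simp add: power_add)
next
  case (sym j k)
  then show ?case by (simp add: add.commute)
qed

text \<open>Splits off exactly the normalising power from
  \<open>cgauss_sum_eq_alpha_sum\<close>.\<close>

lemma bailey_alpha_eq_weight: "bailey_alpha q (Suc p) k = weight q p k * q ^ (k\<^sup>2)"
proof -
  have "(k + 1 choose 2) = k + (k choose 2)" by (simp add: numeral_2_eq_2)
  then have "(k choose 2) + Suc p * (k\<^sup>2 + k) = (k + 1 choose 2) + p * (k\<^sup>2 + k) + k\<^sup>2"
    by simp
  then show ?thesis unfolding bailey_alpha_def weight_def by (simp only: power_add mult.assoc)
qed

text \<open>For k = N-1-j the coefficient \<open>q ^ (2 * k + 1)\<close> completes the square to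
  (k+1)^2, leaving a difference of consecutive partial sums of \<open>alpha\<close>.\<close>

lemma cgauss_sum_diff:
  assumes "primitive_unity_root N q" and "j < N"
  shows "q ^ ((N - Suc j)\<^sup>2) * (cgauss_sum q N (N - Suc j) -
    q ^ (2 * (N - Suc j) + 1) * cgauss_sum q N (N - Suc j + 1)) = alpha q j"
proof -
  define k where "k = N - Suc j"
  have k: "k + j = N - 1" using assms(2) by (simp add: k_def)
  have V0: "q ^ (k\<^sup>2) * cgauss_sum q N k = alpha_sum q j"
    by (rule cgauss_sum_eq_alpha_sum[OF assms(1) k])
  have e: "k\<^sup>2 + (2 * k + 1) = (k + 1)\<^sup>2" by (simp add: power2_eq_square)
  have "q ^ (k\<^sup>2) * (cgauss_sum q N k - q ^ (2 * k + 1) * cgauss_sum q N (k + 1)) =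
      alpha_sum q j - q ^ ((k + 1)\<^sup>2) * cgauss_sum q N (k + 1)"
    unfolding e[symmetric] power_add[of q "k\<^sup>2"] right_diff_distrib V0 by (simp only: mult.assoc)
  also have "\<dots> = alpha q j"
  proof (cases j)
    case 0
    then have "cgauss_sum q N (k + 1) = 0"
      using assms(2) by (auto simp: k_def cgauss_sum_def cgauss_def intro!: sum.neutral)
    then show ?thesis using 0 by (simp add: alpha_0)
  next
    case (Suc i)
    then have "q ^ ((k + 1)\<^sup>2) * cgauss_sum q N (k + 1) = alpha_sum q i"
      using k by (intro cgauss_sum_eq_alpha_sum[OF assms(1)]) simp
    then show ?thesis using Suc by (simp only: alpha_Suc)
  qed
  finally show ?thesis unfolding k_def .
qed

theorem theorem2p10:
  fixes p N :: nat and q :: complex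
  assumes "p \<ge> 1" and "N \<ge> 1" and "primitive_unity_root N q"
  shows "H4 p q =
    (\<Sum>k=0..N-1. (-1) ^ k * q ^ ((k + 1 choose 2) + (p - 1) * (k\<^sup>2 + k)) * alpha q k)"
proof -
  have p: "p = Suc (p - 1)" using assms(1) by simp
  have "q ^ N = 1" using assms(3) by (simp add: primitive_unity_root_def)
  then have norm: "norm q \<le> 1" using power_eq_1_iff[of q N] assms(2) by auto
  let ?d = "\<lambda>n k. cgauss q n k - q ^ (2 * k + 1) * cgauss q n (k + 1)"
  have "H4 p q = (\<Sum>n<N. q ^ n * (\<Sum>k\<le>n. bailey_alpha q p k * ?d n k))"
    unfolding H4_eq_chain_sum[OF assms(3,1)] chain_sum_cgauss[OF norm] ..
  \<comment> \<open>Terms with n < k vanish, so the range becomes a square and the sums can be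
    exchanged.\<close>
  also have "\<dots> = (\<Sum>n<N. q ^ n * (\<Sum>k<N. bailey_alpha q p k * ?d n k))"
    by (intro sum.cong refl arg_cong2[where f = "(*)"] sum.mono_neutral_left) (auto simp: cgauss_def)
  also have "\<dots> = (\<Sum>k<N. \<Sum>n<N. bailey_alpha q p k * (q ^ n * ?d n k))"
    unfolding sum_distrib_left by (subst sum.swap) (simp add: mult_ac)
  also have "\<dots> = (\<Sum>k<N. bailey_alpha q p k *
      (cgauss_sum q N k - q ^ (2 * k + 1) * cgauss_sum q N (k + 1)))"
    unfolding cgauss_sum_def sum_distrib_left sum_subtractf[symmetric]
    by (intro sum.cong refl) (simp add: algebra_simps)
  also have "\<dots> = (\<Sum>k<N. weight q (p - 1) k * (q ^ (k\<^sup>2) *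
      (cgauss_sum q N k - q ^ (2 * k + 1) * cgauss_sum q N (k + 1))))"
    by (subst p) (simp only: bailey_alpha_eq_weight mult.assoc)
  \<comment> \<open>Reversal k = N-1-j, which turns the differences into \<open>alpha q j\<close>;
    the weight is reflected back afterwards.\<close>
  also have "\<dots> = (\<Sum>j<N. weight q (p - 1) (N - Suc j) * alpha q j)"
    by (subst sum.nat_diff_reindex[symmetric], intro sum.cong refl) (simp only: cgauss_sum_diff[OF assms(3)] lessThan_iff)
  also have "\<dots> = (\<Sum>j<N. weight q (p - 1) j * alpha q j)"
    using weight_reflect[OF assms(3)] by (intro sum.cong refl arg_cong2[where f = "(*)"]) auto
  also have "{..<N} = {0..N-1}" using assms(2) by auto
  finally show ?thesis unfolding weight_def .
qed

end
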